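(* For $n\ge 1$, \[ P_n(x)=\frac12\sum_{j=0}^{n+1}\left\{\binom{n+1}{j}x+\binom{n}{j-1}\right\}B_{n-1}^{(n)}(x+j), \] with the convention $\binom{n}{-1}=0$.
   Context: The Pidduck polynomials $P_n(x)$ are defined by $\sum_{k\ge0}P_k(x)\frac{t^k}{k!}=(1-t)^{-1}\left(\frac{1+t}{1-t}\right)^x$ (equivalently, $P_n(x)$ is the Sheffer sequence for $\left(\frac{2}{e^t+1},\frac{e^t-1}{e^t+1}\right)$). For real $r$, the Bernoulli polynomials of order $r$ are defined by $\left(\frac{t}{e^t-1}\right)^re^{xt}=\sum_{n\ge0}B_n^{(r)}(x)\frac{t^n}{n!}$. *)

theory Defs
  imports "HOL-Computational_Algebra.Computational_Algebra"
begin

(* The power f^r = (1 + (f - 1))^r = sum_k (r gchoose k) (f - 1)^k of a formal power series f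
   with constant term 1, for an arbitrary exponent r in the coefficient field. *)
definition fps_gpow :: "'a::field_char_0 fps \<Rightarrow> 'a \<Rightarrow> 'a fps" where
  "fps_gpow f r = fps_binomial r oo (f - 1)"

definition pidduck :: "nat \<Rightarrow> 'a::field_char_0 \<Rightarrow> 'a" where
  "pidduck n x =
     fact n * fps_nth (inverse (1 - fps_X) * fps_gpow ((1 + fps_X) / (1 - fps_X)) x) n"

definition bernoulli_ord :: "'a::field_char_0 \<Rightarrow> nat \<Rightarrow> 'a \<Rightarrow> 'a" where
  "bernoulli_ord r n x =
     fact n * fps_nth (fps_gpow (fps_X / (fps_exp 1 - 1)) r * fps_exp x) n"

lemma fps_gpow_of_nat:
  assumes "fps_nth f 0 = 1"
  shows "fps_gpow f (of_nat k) = f ^ k"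
proof -
  have 0: "fps_nth (f - 1) 0 = 0"
    using assms by simp
  have "fps_gpow f (of_nat k) = ((1 + fps_X) oo (f - 1)) ^ k"
    unfolding fps_gpow_def fps_binomial_of_nat by (rule fps_compose_power [OF 0, symmetric])
  also have "(1 + fps_X) oo (f - 1) = f"
    by (simp add: fps_compose_add_distrib fps_X_fps_compose_startby0 assms)
  finally show ?thesis .
qed

lemma fps_gpow_add:
  assumes "fps_nth f 0 = 1"
  shows "fps_gpow f (r + s) = fps_gpow f r * fps_gpow f s"
  using assms by (simp add: fps_gpow_def fps_binomial_add_mult fps_compose_mult_distrib)

lemma pidduck_base_nth_0:
  "fps_nth ((1 + fps_X) / (1 - fps_X) :: 'a::field_char_0 fps) 0 = 1"
  by (simp add: fps_divide_unit)

lemma bernoulli_base_nth_0: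
  "fps_nth (fps_X / (fps_exp 1 - 1) :: 'a::field_char_0 fps) 0 = 1"
proof -
  let ?e = "fps_exp 1 - 1 :: 'a fps"
  have sd: "subdegree ?e = 1"
    by (rule subdegreeI) auto
  have "fps_nth (fps_X / ?e) 0 = fps_nth fps_X 1 / fps_nth ?e 1"
    using fps_divide_nth_base[of ?e fps_X] sd by simp
  then show ?thesis by simp
qed

lemma pidduck_generating_function:
  "Abs_fps (\<lambda>k. pidduck k x / fact k) =
     inverse (1 - fps_X) * fps_gpow ((1 + fps_X) / (1 - fps_X)) x"
  by (rule fps_ext) (simp add: pidduck_def)

lemma bernoulli_ord_generating_function:
  "Abs_fps (\<lambda>n. bernoulli_ord r n x / fact n) =
     fps_gpow (fps_X / (fps_exp 1 - 1)) r * fps_exp x"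
  by (rule fps_ext) (simp add: bernoulli_ord_def)

lemma gbinomial_polynomial:
  "\<exists>p :: 'a::field_char_0 poly. \<forall>x. poly p x = x gchoose k"
proof
  show "\<forall>x. poly (smult (1 / fact k) (\<Prod>i = 0..<k. [:- of_nat i, 1:])) x = x gchoose k"
    by (simp add: gbinomial_prod_rev poly_prod)
qed

lemma pidduck_polynomial:
  "\<exists>p :: 'a::field_char_0 poly. \<forall>x. poly p x = pidduck n x"
proof -
  obtain q :: "nat \<Rightarrow> 'a poly" where q: "\<And>k x. poly (q k) x = x gchoose k"
    using gbinomial_polynomial by metis
  let ?f = "(1 + fps_X) / (1 - fps_X) - 1 :: 'a fps"
  let ?h = "inverse (1 - fps_X) :: 'a fps"
  let ?p = "smult (fact n) (\<Sum>i = 0..n. smult (fps_nth ?h i)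
              (\<Sum>k = 0..n - i. smult (fps_nth (?f ^ k) (n - i)) (q k)))"
  have "poly ?p x = pidduck n x" for x
    by (simp add: pidduck_def fps_gpow_def fps_mult_nth fps_compose_nth poly_sum q mult.commute)
  then show ?thesis by blast
qed

lemma bernoulli_ord_polynomial:
  "\<exists>p :: 'a::field_char_0 poly. \<forall>x. poly p x = bernoulli_ord r n x"
proof -
  let ?h = "fps_gpow (fps_X / (fps_exp 1 - 1)) r"
  let ?p = "smult (fact n) (\<Sum>i = 0..n. monom (fps_nth ?h i / fact (n - i)) (n - i))"
  have "poly ?p x = bernoulli_ord r n x" for x
    by (simp add: bernoulli_ord_def fps_mult_nth poly_sum poly_monom)
  then show ?thesis by blast
qed

end

theory Submission
  imports Defs
begin

text \<open>
  The series \<open>g(z) = (e\<^sup>z - 1) / (e\<^sup>z + 1)\<close> is the compositional inverse of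
  \<open>log ((1 + t) / (1 - t))\<close>, so substituting \<open>t = g(z)\<close> turns twice the generating function
  of the Pidduck polynomials into \<open>H(z) = (1 + e\<^sup>z) e\<^sup>x\<^sup>z\<close>. By Lagrange inversion,
  \<open>2 n P\<^sub>n(x) / n!\<close> is the coefficient of \<open>z\<^sup>n\<^sup>-\<^sup>1\<close> in
  \<open>H'(z) (z / g(z))\<^sup>n = (z / (e\<^sup>z - 1))\<^sup>n e\<^sup>x\<^sup>z (x (1 + e\<^sup>z)\<^sup>n\<^sup>+\<^sup>1 + e\<^sup>z (1 + e\<^sup>z)\<^sup>n)\<close>.
  Expanding the last factor in powers of \<open>e\<^sup>z\<close> yields the Bernoulli polynomials of order \<open>n\<close>.
\<close>

text \<open>Since \<open>g ^ k\<close> has order at least k, every inner sum of the composition may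
  run up to the same bound n, and the double sum can be interchanged.\<close>

lemma fps_compose_mult_nth:
  fixes f g h :: "'a::idom fps"
  assumes "g $ 0 = 0"
  shows "((f oo g) * h) $ n = (\<Sum>k\<le>n. f $ k * (g ^ k * h) $ n)"
proof -
  have "((f oo g) * h) $ n = (\<Sum>i\<le>n. (\<Sum>k\<le>n. f $ k * (g ^ k) $ i) * h $ (n - i))"
    unfolding fps_mult_nth atLeast0AtMost
  proof (intro sum.cong refl arg_cong2[where f="(*)"])
    fix i assume "i \<in> {..n}"
    then show "(f oo g) $ i = (\<Sum>k\<le>n. f $ k * (g ^ k) $ i)"
      unfolding fps_compose_nth
      by (intro sum.mono_neutral_left) (auto simp: startsby_zero_power_prefix[OF assms])
  qed
  also have "\<dots> = (\<Sum>i\<le>n. \<Sum>k\<le>n. f $ k * ((g ^ k) $ i * h $ (n - i)))"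
    by (simp add: sum_distrib_right mult.assoc)
  also have "\<dots> = (\<Sum>k\<le>n. \<Sum>i\<le>n. f $ k * ((g ^ k) $ i * h $ (n - i)))"
    by (rule sum.swap)
  also have "\<dots> = (\<Sum>k\<le>n. f $ k * (g ^ k * h) $ n)"
    by (simp add: fps_mult_nth sum_distrib_left atLeast0AtMost)
  finally show ?thesis .
qed

text \<open>For g = X/p this coefficient is the residue of g'/g^(m+1). For m > 0 that is the
  derivative of -1/(m g^m), so its residue vanishes; the proof expresses this without Laurent
  series.\<close>

lemma fps_deriv_X_div_mult_power_nth:
  fixes p :: "'a::field_char_0 fps"
  assumes "p $ 0 \<noteq> 0"
  shows "(fps_deriv (fps_X * inverse p) * p ^ Suc m) $ m = (if m = 0 then 1 else 0)"
proof -
  have inv: "inverse p * p = 1"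
    using assms by (rule inverse_mult_eq_1)
  have d: "fps_deriv (fps_X * inverse p) * p\<^sup>2 = p - fps_X * fps_deriv p"
  proof -
    have "fps_deriv (fps_X * inverse p) * p\<^sup>2
        = (inverse p * p) * p - fps_X * fps_deriv p * (inverse p * p)\<^sup>2"
      using assms by (simp add: fps_inverse_deriv algebra_simps power2_eq_square)
    then show ?thesis
      by (simp add: inv)
  qed
  show ?thesis
  proof (cases m)
    case 0
    then show ?thesis
      using assms by (simp add: fps_inverse_deriv)
  next
    case (Suc l)
    have "of_nat m * (fps_deriv (fps_X * inverse p) * p ^ Suc m)
        = of_nat m * ((fps_deriv (fps_X * inverse p) * p\<^sup>2) * p ^ l)"
      by (simp add: Suc power2_eq_square mult.assoc)
    also have "\<dots> = of_nat m * p ^ m - fps_X * fps_deriv (p ^ m)"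
      unfolding d Suc fps_deriv_power
      by (simp add: algebra_simps fps_of_nat flip: fps_const_add)
    also have "\<dots> $ m = 0"
    proof -
      \<comment> \<open>The operator X d/dX multiplies the coefficient at m by m.\<close>
      have "(of_nat m * q - fps_X * fps_deriv q) $ m = 0" for q :: "'a fps"
        by (simp add: Suc flip: of_nat_Suc)
      then show ?thesis .
    qed
    finally have "of_nat m * (fps_deriv (fps_X * inverse p) * p ^ Suc m) $ m = 0"
      by (simp only: fps_mult_of_nat_nth)
    then show ?thesis
      unfolding Suc by (simp only: mult_eq_0_iff of_nat_eq_0_iff) simp
  qed
qed

text \<open>The chain rule expands the left side in terms g^k g' p^(n+1) with g = X/p, and the
  residue computation keeps only k = n.\<close>

lemma fps_lagrange_inversion:
  fixes f p :: "'a::field_char_0 fps"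
  assumes "p $ 0 \<noteq> 0"
  shows "(fps_deriv (f oo (fps_X * inverse p)) * p ^ Suc n) $ n = of_nat (Suc n) * f $ Suc n"
proof -
  let ?g = "fps_X * inverse p"
  \<comment> \<open>Cancelling p^k against g^k leaves X^k, which shifts the coefficient to n -
    k.\<close>
  have *: "(?g ^ k * (fps_deriv ?g * p ^ Suc n)) $ n = (if k = n then 1 else 0)" if "k \<le> n" for k
  proof -
    have "p ^ Suc n = p ^ k * p ^ Suc (n - k)"
      using that by (simp flip: power_add)
    then have "?g ^ k * (fps_deriv ?g * p ^ Suc n)
        = fps_X ^ k * (inverse p * p) ^ k * (fps_deriv ?g * p ^ Suc (n - k))"
      by (simp only: power_mult_distrib mult_ac)
    also have "\<dots> = fps_X ^ k * (fps_deriv ?g * p ^ Suc (n - k))"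
      using assms by (simp add: inverse_mult_eq_1)
    finally have *: "?g ^ k * (fps_deriv ?g * p ^ Suc n)
        = fps_X ^ k * (fps_deriv ?g * p ^ Suc (n - k))" .
    show ?thesis
      unfolding * fps_X_power_mult_nth fps_deriv_X_div_mult_power_nth[OF assms]
      using that by auto
  qed
  have "fps_deriv (f oo ?g) * p ^ Suc n = (fps_deriv f oo ?g) * (fps_deriv ?g * p ^ Suc n)"
    by (subst fps_compose_deriv) (simp_all add: mult.assoc)
  then have "(fps_deriv (f oo ?g) * p ^ Suc n) $ n
      = (\<Sum>k\<le>n. fps_deriv f $ k * (?g ^ k * (fps_deriv ?g * p ^ Suc n)) $ n)"
    by (simp only:) (rule fps_compose_mult_nth, simp)
  also have "\<dots> = (\<Sum>k\<le>n. fps_deriv f $ k * (if k = n then 1 else 0))"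
    by (intro sum.cong refl) (simp only: * atMost_iff)
  also have "\<dots> = of_nat (Suc n) * f $ Suc n"
    by (simp add: if_distrib cong: if_cong)
  finally show ?thesis .
qed

text \<open>Both sides solve y' = x y with y(0) = 1; the equation comes from (1 + X) y' = x y for
  the binomial series.\<close>

lemma fps_binomial_compose_exp:
  "fps_binomial x oo (fps_exp 1 - 1) = fps_exp (x :: 'a::field_char_0)"
proof -
  let ?e = "fps_exp 1 - 1 :: 'a fps"
  have e0: "?e $ 0 = 0"
    by simp
  have "(1 + fps_X) * fps_deriv (fps_binomial x) = fps_const x * fps_binomial x"
    by (simp add: fps_binomial_deriv fps_divide_unit mult_ac inverse_mult_eq_1')
  then have "((1 + fps_X) * fps_deriv (fps_binomial x)) oo ?e = (fps_const x * fps_binomial x) oo ?e"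
    by simp
  then have "fps_exp 1 * (fps_deriv (fps_binomial x) oo ?e) = fps_const x * (fps_binomial x oo ?e)"
    by (simp add: fps_compose_mult_distrib[OF e0] fps_compose_add_distrib)
  then have "fps_deriv (fps_binomial x oo ?e) = fps_const x * (fps_binomial x oo ?e)"
    by (simp add: fps_compose_deriv mult.commute)
  then show ?thesis
    by (subst (asm) fps_exp_unique_ODE) simp
qed

text \<open>The relation for g gives 2/(1 - g) = 1 + e^z and (1 + g)/(1 - g) = e^z, which settles
  the two factors separately.\<close>

lemma pidduck_gf_compose:
  fixes g :: "'a::field_char_0 fps"
  assumes g0: "g $ 0 = 0" and g: "g * (1 + fps_exp 1) = fps_exp 1 - 1"
  shows "(2 * (inverse (1 - fps_X) * fps_gpow ((1 + fps_X) / (1 - fps_X)) x)) oo g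
    = (1 + fps_exp 1) * fps_exp x"
proof -
  let ?i = "inverse (1 - fps_X) :: 'a fps"
  have i: "(1 - fps_X) * ?i = 1"
    by (simp add: inverse_mult_eq_1')
  have "(1 - g) * (?i oo g) = ((1 - fps_X) * ?i) oo g"
    by (simp add: fps_compose_mult_distrib[OF g0] fps_compose_sub_distrib g0)
  then have gi: "(1 - g) * (?i oo g) = 1"
    by (simp add: i)
  have "(1 + fps_exp 1) * (1 - g) = 2"
    using g by (simp add: algebra_simps)
  then have ig: "2 * (?i oo g) = 1 + fps_exp 1"
    by (metis gi mult.assoc mult.right_neutral)
  have "(1 + fps_X) / (1 - fps_X) - 1 = (1 + fps_X) * ?i - (1 - fps_X) * ?i"
    by (simp add: i fps_divide_unit)
  also have "\<dots> = fps_X * (2 * ?i)"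
    by (simp add: algebra_simps)
  finally have "(1 + fps_X) / (1 - fps_X) - 1 = fps_X * (2 * ?i)" .
  then have "((1 + fps_X) / (1 - fps_X) - 1) oo g = g * (2 * (?i oo g))"
    by (simp add: fps_compose_mult_distrib[OF g0] g0)
  then have b: "((1 + fps_X) / (1 - fps_X) - 1) oo g = fps_exp 1 - 1"
    by (simp add: ig g)
  have "fps_gpow ((1 + fps_X) / (1 - fps_X)) x oo g
      = fps_binomial x oo (((1 + fps_X) / (1 - fps_X) - 1) oo g)"
    unfolding fps_gpow_def
    by (rule fps_compose_assoc[symmetric]) (simp_all add: g0 pidduck_base_nth_0)
  also have "\<dots> = fps_exp x"
    unfolding b by (rule fps_binomial_compose_exp)
  finally show ?thesis
    by (simp add: fps_compose_mult_distrib[OF g0] mult.assoc flip: ig)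
qed

lemma fps_exp_binomial_sum:
  "(\<Sum>j\<le>n. of_nat (n choose j) * fps_exp (of_nat j)) = (1 + fps_exp (1::'a::field_char_0)) ^ n"
  by (subst add.commute, subst binomial_ring) (simp add: fps_exp_power_mult)

lemma fps_weighted_exp_sum:
  fixes x :: "'a::field_char_0"
  shows "(\<Sum>j = 0..n + 1. fps_const (of_nat ((n + 1) choose j) * x
      + (if j = 0 then 0 else of_nat (n choose (j - 1)))) * fps_exp (x + of_nat j))
    = fps_deriv ((1 + fps_exp 1) * fps_exp x) * (1 + fps_exp 1) ^ n"
    (is "?L = _")
proof -
  let ?E = "fps_exp 1 :: 'a fps"
  have "?L = fps_exp x * (fps_const x
        * (\<Sum>j\<le>Suc n. of_nat (Suc n choose j) * fps_exp (of_nat j))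
      + (\<Sum>j\<le>Suc n. (if j = 0 then 0 else of_nat (n choose (j - 1))) * fps_exp (of_nat j)))"
    unfolding atLeast0AtMost sum_distrib_left sum.distrib[symmetric] Suc_eq_plus1
    by (intro sum.cong refl)
      (simp add: fps_exp_add_mult fps_of_nat algebra_simps
        flip: fps_const_add fps_const_mult)
  \<comment> \<open>The term at j = 0 vanishes; shifting j by one pulls out a factor e^z.\<close>
  also have "(\<Sum>j\<le>Suc n. (if j = 0 then 0 else of_nat (n choose (j - 1))) * fps_exp (of_nat j))
      = ?E * (1 + ?E) ^ n"
    unfolding sum.atMost_Suc_shift
    by (simp add: fps_exp_add_mult sum_distrib_left mult_ac flip: fps_exp_binomial_sum)
  also have "(\<Sum>j\<le>Suc n. of_nat (Suc n choose j) * fps_exp (of_nat j)) = (1 + ?E) ^ Suc n"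
    by (rule fps_exp_binomial_sum)
  finally show ?thesis
    by (simp add: algebra_simps)
qed

theorem theorem8:
  fixes n :: nat and x :: "'a::field_char_0"
  assumes "n \<ge> 1"
  shows "pidduck n x =
    1 / 2 * (\<Sum>j = 0..n + 1.
      (of_nat ((n + 1) choose j) * x + (if j = 0 then 0 else of_nat (n choose (j - 1)))) *
      bernoulli_ord (of_nat n) (n - 1) (x + of_nat j))"
proof -
  obtain m where n: "n = Suc m"
    using assms by (cases n) auto
  define b :: "'a fps" where "b = fps_X / (fps_exp 1 - 1)"
  \<comment> \<open>\<open>p\<close> is z/g(z), so g is recovered below as
    \<open>fps_X * inverse p\<close>.\<close>
  define p where "p = b * (1 + fps_exp 1)"
  define F :: "'a fps"
    where "F = 2 * (inverse (1 - fps_X) * fps_gpow ((1 + fps_X) / (1 - fps_X)) x)"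
  define c :: "nat \<Rightarrow> 'a" where
    "c j = of_nat ((n + 1) choose j) * x + (if j = 0 then 0 else of_nat (n choose (j - 1)))" for j
  have b0: "b $ 0 = 1"
    unfolding b_def by (rule bernoulli_base_nth_0)
  have p0: "p $ 0 \<noteq> 0"
    by (simp add: p_def b0)
  \<comment> \<open>Both e^z - 1 and X have order 1, so the division defining \<open>b\<close> is
    exact.\<close>
  have "subdegree (fps_exp 1 - 1 :: 'a fps) = 1"
    by (rule subdegreeI) auto
  then have "(fps_exp 1 - 1 :: 'a fps) dvd fps_X"
    by (subst fps_dvd_iff) auto
  then have b: "b * (fps_exp 1 - 1) = fps_X"
    unfolding b_def by (rule dvd_div_mult_self)
  have "fps_X * inverse p * (1 + fps_exp 1) = (fps_exp 1 - 1) * (inverse p * p)"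
    by (simp add: p_def mult_ac flip: b)
  then have g: "fps_X * inverse p * (1 + fps_exp 1) = fps_exp 1 - 1"
    by (simp add: inverse_mult_eq_1[OF p0])
  have F: "F oo (fps_X * inverse p) = (1 + fps_exp 1) * fps_exp x"
    unfolding F_def by (rule pidduck_gf_compose[OF _ g]) simp
  \<comment> \<open>At the natural order n the general power of \<open>b\<close> is the ordinary
    one.\<close>
  have bern: "bernoulli_ord (of_nat n) m y = fact m * (b ^ n * fps_exp y) $ m" for y
    using b0 by (simp add: bernoulli_ord_def b_def fps_gpow_of_nat)
  have "(\<Sum>j = 0..n + 1. c j * bernoulli_ord (of_nat n) m (x + of_nat j))
      = fact m * (b ^ n * (\<Sum>j = 0..n + 1. fps_const (c j) * fps_exp (x + of_nat j))) $ m"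
    by (simp add: bern sum_distrib_left fps_sum_nth mult.left_commute[of _ "fps_const _"]
        mult.left_commute[of "c _"] del: sum.cl_ivl_Suc)
  also have "b ^ n * (\<Sum>j = 0..n + 1. fps_const (c j) * fps_exp (x + of_nat j))
      = fps_deriv (F oo (fps_X * inverse p)) * p ^ n"
    unfolding c_def fps_weighted_exp_sum F by (simp only: p_def power_mult_distrib mult_ac)
  \<comment> \<open>Lagrange inversion contributes the factor n = m + 1 that turns
    \<open>fact m\<close> into \<open>fact n\<close>.\<close>
  also have "fact m * (\<dots> $ m) = fact n * F $ n"
    unfolding n fps_lagrange_inversion[OF p0] by simp
  also have "\<dots> = 2 * pidduck n x"
    by (simp add: F_def pidduck_def numeral_fps_const)
  finally show ?thesis
    by (simp add: c_def n)
qed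

end
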